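(* Let $n\ge 4$. Up to isomorphism, there are exactly $\frac{n^2-9n+22}{2}$ simplicial complexes with $n$ vertices in $\mathrm{mGU}(2)$, and the complexes $\mathcal{J}(i,j,n)$ with $(i,j)\in Q_n$ form a set of pairwise nonisomorphic representatives of these isomorphism classes.
   Context: A simplicial complex is a pair $(V,H)$ with $V$ finite nonempty, $H\subseteq 2^V$ containing all singletons and closed under subsets; its dimension is $\max\{|X|:X\in H\}-1$. $P_k(V)$, $P_{\le k}(V)$ denote subsets with exactly, at most $k$ elements. $\mathrm{Pav}(d)$ is the class of complexes of dimension $d$ with $P_{\le d}(V)\subseteq H$. For $(V,H)\in\mathrm{Pav}(d)$, $T(H)=\{T\subseteq V\mid X\cup\{p\}\in H \text{ for all } X\in H\cap P_{\le d}(V),\ X\subseteq T,\ p\in V\setminus T\}$, and $J(T(H))$ is the set of all sets $\{x_1,\dots,x_k\}$ for which there is a chain $T_0\subset\cdots\subset T_k$ in $T(H)$ with $x_i\in T_i\setminus T_{i-1}$. $(V,H)\in\mathrm{Pav}(d)$ goes up if $\dim(V,J(T(H)))>d$; $\mathrm{GU}(d)$ and $\mathrm{NGU}(d)$ are the classes of complexes in $\mathrm{Pav}(d)$ which go up, resp. do not go up. $\mathrm{mGU}(d)$ is the class of $(V,H)\in\mathrm{GU}(d)$ such that $(V,H')\in\mathrm{NGU}(d)$ whenever $H\supsetneq H'\supsetneq P_{\le d}(V)$. Let $V_n=\{1,\dots,n\}$. For $2\le i<j<n$, $\mathcal{J}(i,j,n)=(V_n,J(i,j,n))$ with $J(i,j,n)=P_{\le2}(V_n)\cup\{\{a,a',b\}\mid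 1\le a<a'\le i<b\le j\}\cup\{\{b,b',c\}\mid 1\le b<b'\le j<c\le n\}$. $Q_n=\{(i,j)\in\mathbb{N}^2\mid 2\le i<j-1<n-2\}\cup\{(2,3)\}$. Two complexes are isomorphic if some bijection between vertex sets maps faces onto faces. *)

theory Defs
  imports Complex_Main
begin

type_synonym 'a scomplex = "'a set \<times> 'a set set"

definition simplicial_complex :: "'a scomplex \<Rightarrow> bool" where
  "simplicial_complex K \<longleftrightarrow> (case K of (V, H) \<Rightarrow>
     finite V \<and> V \<noteq> {} \<and> H \<subseteq> Pow V \<and> (\<forall>v\<in>V. {v} \<in> H) \<and>
     (\<forall>X\<in>H. \<forall>Y. Y \<subseteq> X \<longrightarrow> Y \<in> H))"

definition dimension :: "'a scomplex \<Rightarrow> int" where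
  "dimension K = int (Max (card ` snd K)) - 1"

definition subsets_le :: "nat \<Rightarrow> 'a set \<Rightarrow> 'a set set" where
  "subsets_le k V = {X. X \<subseteq> V \<and> finite X \<and> card X \<le> k}"

definition Pav :: "nat \<Rightarrow> 'a scomplex set" where
  "Pav d = {(V, H). simplicial_complex (V, H) \<and> dimension (V, H) = int d \<and>
     subsets_le d V \<subseteq> H}"

definition transversal_flats :: "nat \<Rightarrow> 'a scomplex \<Rightarrow> 'a set set" where
  "transversal_flats d K = (case K of (V, H) \<Rightarrow>
     {T. T \<subseteq> V \<and>
        (\<forall>X \<in> H \<inter> subsets_le d V. \<forall>p \<in> V - T. X \<subseteq> T \<longrightarrow> X \<union> {p} \<in> H)})"

definition chain_transversals :: "'a set set \<Rightarrow> 'a set set" where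
  "chain_transversals F = {X. \<exists>(k::nat) (T :: nat \<Rightarrow> 'a set) (x :: nat \<Rightarrow> 'a).
     (\<forall>i\<le>k. T i \<in> F) \<and> (\<forall>i\<in>{1..k}. T (i - 1) \<subset> T i) \<and>
     (\<forall>i\<in>{1..k}. x i \<in> T i - T (i - 1)) \<and> X = x ` {1..k}}"

definition goes_up :: "nat \<Rightarrow> 'a scomplex \<Rightarrow> bool" where
  "goes_up d K \<longleftrightarrow>
     dimension (fst K, chain_transversals (transversal_flats d K)) > int d"

definition GU :: "nat \<Rightarrow> 'a scomplex set" where
  "GU d = {K \<in> Pav d. goes_up d K}"

definition NGU :: "nat \<Rightarrow> 'a scomplex set" where
  "NGU d = {K \<in> Pav d. \<not> goes_up d K}"

definition mGU :: "nat \<Rightarrow> 'a scomplex set" where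
  "mGU d = {(V, H). (V, H) \<in> GU d \<and>
     (\<forall>H'. H' \<subset> H \<and> subsets_le d V \<subset> H' \<longrightarrow> (V, H') \<in> NGU d)}"

definition isomorphic :: "'a scomplex \<Rightarrow> 'b scomplex \<Rightarrow> bool" where
  "isomorphic K L \<longleftrightarrow>
     (\<exists>f. bij_betw f (fst K) (fst L) \<and> (\<lambda>X. f ` X) ` snd K = snd L)"

definition mGU_on :: "nat \<Rightarrow> nat \<Rightarrow> 'a scomplex set" where
  "mGU_on d n = {K \<in> mGU d. card (fst K) = n}"

definition iso_rel_on :: "'a scomplex set \<Rightarrow> ('a scomplex \<times> 'a scomplex) set" where
  "iso_rel_on S = {(K, L). K \<in> S \<and> L \<in> S \<and> isomorphic K L}"

definition J_complex :: "nat \<Rightarrow> nat \<Rightarrow> nat \<Rightarrow> nat scomplex" where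
  "J_complex i j n = ({1..n},
     subsets_le 2 {1..n}
     \<union> {{a, a', b} | a a' b. 1 \<le> a \<and> a < a' \<and> a' \<le> i \<and> i < b \<and> b \<le> j}
     \<union> {{b, b', c} | b b' c. 1 \<le> b \<and> b < b' \<and> b' \<le> j \<and> j < c \<and> c \<le> n})"

text \<open>Truncated subtraction is harmless here: \<open>2 \<le> i < j - 1 < n - 2\<close> forces \<open>j > 1\<close> and
  \<open>n > 2\<close>, both over the naturals and over the integers.\<close>

definition Q_set :: "nat \<Rightarrow> (nat \<times> nat) set" where
  "Q_set n = {(i, j). 2 \<le> i \<and> i < j - 1 \<and> j - 1 < n - 2} \<union> {(2, 3)}"

end

theory Submission
  imports Defs
begin

text \<open>
  A proper subset \<open>T\<close> of \<open>V\<close> is a flat of \<open>H \<in> Pav 2\<close> iff all triples meeting \<open>T\<close> in exactly two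
  points are faces; singletons and the empty set are always flats. Hence \<open>H\<close> goes up iff it
  has flats \<open>A \<subset> B \<subset> V\<close> with \<open>|A| \<ge> 2\<close>, and the complexes in \<open>mGU 2\<close> are the inclusion-minimal ones
  among the complexes \<open>pair_faces V A B\<close> generated by such pairs.

  If \<open>B - A\<close> and \<open>V - B\<close> both have at least two elements, then \<open>A\<close> and \<open>B\<close> are the only proper flats
  of \<open>pair_faces V A B\<close> with at least two elements, so the complex is minimal and determines \<open>|A|\<close> and
  \<open>|B|\<close>. If \<open>|A| = 2\<close> and \<open>|B| = 3\<close>, the faces of size three are the triples meeting \<open>B\<close> in at least two
  points, and every pair of flats generates the same complex. In the remaining cases the
  complex contains one of the previous two kinds, with a two-element first set.
\<close>

section \<open>Flats and going up in dimension two\<close>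

text \<open>For \<open>A\<close> and \<open>B\<close> inside \<open>V\<close>, this is the least
  family above \<open>subsets_le 2 V\<close> in which both are flats. Allowing \<open>x = y\<close>
  only gives sets with at most two elements.\<close>

definition pair_faces :: "'a set \<Rightarrow> 'a set \<Rightarrow> 'a set \<Rightarrow> 'a set set" where
  "pair_faces V A B = subsets_le 2 V
     \<union> {{x, y, p} | x y p. x \<in> A \<and> y \<in> A \<and> p \<in> V - A}
     \<union> {{x, y, p} | x y p. x \<in> B \<and> y \<in> B \<and> p \<in> V - B}"

text \<open>The cardinality bound leaves room for a singleton strictly between \<open>{}\<close> and
  \<open>A\<close>; it also forces \<open>A\<close> to be finite, since infinite sets have
  cardinality 0.\<close>

definition flag_pair :: "'a set \<Rightarrow> 'a set \<Rightarrow> 'a set \<Rightarrow> bool" where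
  "flag_pair V A B \<longleftrightarrow> A \<subset> B \<and> B \<subset> V \<and> 2 \<le> card A"

definition flat_in :: "'a set \<Rightarrow> 'a set set \<Rightarrow> 'a set \<Rightarrow> bool" where
  "flat_in V H T \<longleftrightarrow> T \<subseteq> V \<and> (\<forall>x\<in>T. \<forall>y\<in>T. \<forall>p\<in>V - T. {x, y, p} \<in> H)"

lemma ex_two_elements:
  assumes "2 \<le> card A"
  obtains x y where "x \<in> A" "y \<in> A" "x \<noteq> y"
proof -
  have "A \<noteq> {}" "finite A" using assms by (auto intro: card_ge_0_finite)
  then obtain x where x: "x \<in> A" by blast
  have "A \<noteq> {x}" using assms by auto
  then show ?thesis using that x by blast
qed

lemma pair_in_subsets_le: "x \<in> V \<Longrightarrow> y \<in> V \<Longrightarrow> {x, y} \<in> subsets_le 2 V"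
  by (simp add: subsets_le_def card_insert_if)

text \<open>If \<open>X\<close> has at most one point, then \<open>X \<union> {p}\<close> has at
  most two and lies in \<open>H\<close> anyway, so only two-point sets \<open>X\<close> impose a
  condition.\<close>

lemma transversal_flats_2:
  assumes "subsets_le 2 V \<subseteq> H"
  shows "transversal_flats 2 (V, H) = {T. flat_in V H T}"
proof -
  have 1: "X \<union> {p} \<in> H" if T: "flat_in V H T" and X: "X \<in> subsets_le 2 V" "X \<subseteq> T" and p: "p \<in> V - T" for T X p
  proof -
    have fin: "finite X" "card X \<le> 2" "X \<subseteq> V" using X by (auto simp: subsets_le_def)
    show ?thesis
    proof (cases "card X = 2")
      case True
      then obtain x y where "X = {x, y}" by (auto simp: card_2_iff)
      moreover have "{x, y, p} = {x, y} \<union> {p}" by auto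
      ultimately show ?thesis using T X p unfolding flat_in_def by (metis insert_subset)
    next
      case False
      then have "card (X \<union> {p}) \<le> 2" using fin by (simp add: card_insert_if)
      then have "X \<union> {p} \<in> subsets_le 2 V" using fin p by (auto simp: subsets_le_def)
      then show ?thesis using assms by blast
    qed
  qed
  have 2: "{x, y, p} \<in> H"
    if T: "\<forall>X\<in>H \<inter> subsets_le 2 V. \<forall>p\<in>V - T. X \<subseteq> T \<longrightarrow> X \<union> {p} \<in> H" and "T \<subseteq> V"
      and xyp: "x \<in> T" "y \<in> T" "p \<in> V - T" for T x y p
  proof -
    have "{x, y} \<in> subsets_le 2 V" using \<open>T \<subseteq> V\<close> xyp by (auto intro!: pair_in_subsets_le)
    then have "{x, y} \<in> H \<inter> subsets_le 2 V" using assms by blast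
    from T[rule_format, OF this xyp(3)] have "{x, y} \<union> {p} \<in> H" using xyp by simp
    moreover have "{x, y, p} = {x, y} \<union> {p}" by auto
    ultimately show ?thesis by simp
  qed
  show ?thesis
  proof (intro set_eqI iffI)
    fix T assume "T \<in> transversal_flats 2 (V, H)"
    then have "T \<subseteq> V" "\<forall>X\<in>H \<inter> subsets_le 2 V. \<forall>p\<in>V - T. X \<subseteq> T \<longrightarrow> X \<union> {p} \<in> H"
      unfolding transversal_flats_def by auto
    with 2 show "T \<in> {T. flat_in V H T}" unfolding flat_in_def by blast
  next
    fix T assume "T \<in> {T. flat_in V H T}"
    then have T: "flat_in V H T" by simp
    then have "T \<subseteq> V" by (simp add: flat_in_def)
    moreover have "X \<union> {p} \<in> H" if "X \<in> H \<inter> subsets_le 2 V" "p \<in> V - T" "X \<subseteq> T" for X p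
      using 1[OF T _ that(3,2)] that(1) by blast
    ultimately show "T \<in> transversal_flats 2 (V, H)"
      unfolding transversal_flats_def prod.case mem_Collect_eq by (intro conjI ballI impI) 
  qed
qed

lemma flat_in_small:
  assumes "subsets_le 2 V \<subseteq> H" "x \<in> V"
  shows "flat_in V H {}" "flat_in V H {x}" "flat_in V H V"
proof -
  have "{x, p} \<in> H" if "p \<in> V" for p
    using assms(1) pair_in_subsets_le[OF assms(2) that] by (rule subsetD)
  then show "flat_in V H {}" "flat_in V H {x}" "flat_in V H V"
    using assms by (auto simp: flat_in_def)
qed

text \<open>Each family of triples in \<open>pair_faces\<close> lists exactly the faces that a flat
  demands. This translates between inclusions of complexes and flats.\<close>

lemma pair_faces_subset_iff:
  assumes "subsets_le 2 V \<subseteq> H" "A \<subseteq> V" "B \<subseteq> V"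
  shows "pair_faces V A B \<subseteq> H \<longleftrightarrow> flat_in V H A \<and> flat_in V H B"
proof -
  have "{{x, y, p} | x y p. x \<in> T \<and> y \<in> T \<and> p \<in> V - T} \<subseteq> H \<longleftrightarrow> flat_in V H T" if "T \<subseteq> V" for T
    using that unfolding flat_in_def by blast
  then show ?thesis using assms by (simp add: pair_faces_def)
qed

text \<open>A transversal with four elements needs a chain of flats with four strict steps. There
  \<open>T 2\<close> and \<open>T 3\<close> are proper subsets of \<open>V\<close>, and
  \<open>T 2\<close> has at least two elements. Conversely, a flag pair extends to the chain
  \<open>{}\<close>, \<open>{a}\<close>, \<open>A\<close>, \<open>B\<close>,
  \<open>V\<close>.\<close>

lemma goes_up_2_iff:
  assumes fin: "finite V" and H: "subsets_le 2 V \<subseteq> H"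
  shows "goes_up 2 (V, H) \<longleftrightarrow> (\<exists>A B. flag_pair V A B \<and> pair_faces V A B \<subseteq> H)"
proof -
  define F where "F = {T. flat_in V H T}"
  have F: "transversal_flats 2 (V, H) = F"
    using transversal_flats_2[OF H] by (simp add: F_def)
  have FV: "T \<subseteq> V" if "T \<in> F" for T using that by (simp add: F_def flat_in_def)
  have "chain_transversals F \<subseteq> Pow V"
    unfolding chain_transversals_def using FV by fastforce
  then have fC: "finite (chain_transversals F)" using fin by (meson finite_Pow_iff finite_subset)
  \<comment> \<open>A chain of length zero has the empty transversal, so \<open>Max\<close> ranges
    over a nonempty set.\<close>
  have "{} \<in> chain_transversals F"
    unfolding chain_transversals_def mem_Collect_eq
    by (rule exI[of _ 0], rule exI[of _ "\<lambda>_. V"]) (auto simp: F_def flat_in_def)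
  \<comment> \<open>The dimension is one less than the largest cardinality, hence the bound
    3.\<close>
  then have "goes_up 2 (V, H) \<longleftrightarrow> (\<exists>X\<in>chain_transversals F. 3 < card X)"
    using fC unfolding goes_up_def dimension_def F
    by (subst Max_gr_iff[of "card ` chain_transversals F" 3, simplified, symmetric]) auto
  also have "\<dots> \<longleftrightarrow> (\<exists>A B. flag_pair V A B \<and> A \<in> F \<and> B \<in> F)"
  proof
    assume "\<exists>X\<in>chain_transversals F. 3 < card X"
    then obtain k T and x :: "nat \<Rightarrow> 'a"
      where T: "\<And>i. i \<le> k \<Longrightarrow> T i \<in> F" "\<And>i. i \<in> {1..k} \<Longrightarrow> T (i - 1) \<subset> T i"
        and k: "3 < card (x ` {1..k})"
      unfolding chain_transversals_def by blast
    have "card (x ` {1..k}) \<le> k" using card_image_le[of "{1..k}" x] by simp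
    then have k4: "4 \<le> k" using k by simp
    have c: "T 0 \<subset> T 1" "T 1 \<subset> T 2" "T 2 \<subset> T 3" "T 3 \<subset> T 4"
      using T(2)[of 1] T(2)[of 2] T(2)[of 3] T(2)[of 4] k4 by auto
    have V: "T i \<subseteq> V" if "i \<le> k" for i using T(1) FV that by blast
    have "finite (T 1)" "finite (T 2)" using V[of 1] V[of 2] k4 fin by (auto intro: finite_subset)
    then have "card (T 0) < card (T 1)" "card (T 1) < card (T 2)"
      using c by (auto intro: psubset_card_mono)
    then have "2 \<le> card (T 2)" by simp
    then have "flag_pair V (T 2) (T 3)" using c V[of 4] k4 by (auto simp: flag_pair_def)
    then show "\<exists>A B. flag_pair V A B \<and> A \<in> F \<and> B \<in> F" using T(1)[of 2] T(1)[of 3] k4 by auto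
  next
    assume "\<exists>A B. flag_pair V A B \<and> A \<in> F \<and> B \<in> F"
    then obtain A B where AB: "A \<subset> B" "B \<subset> V" "2 \<le> card A" "A \<in> F" "B \<in> F"
      by (auto simp: flag_pair_def)
    obtain a a' where a: "a \<in> A" "a' \<in> A" "a \<noteq> a'" using ex_two_elements AB(3) by blast
    obtain b c where b: "b \<in> B" "b \<notin> A" and c: "c \<in> V" "c \<notin> B" using AB by blast
    define T where "T = (\<lambda>i::nat. [{}, {a}, A, B, V] ! i)"
    \<comment> \<open>Transversals are indexed from 1, so the entry at index 0 is a dummy.\<close>
    define x where "x = (\<lambda>i::nat. [a, a, a', b, c] ! i)"
    have aV: "a \<in> V" using a AB by auto
    have i4: "{1..4::nat} = {1, 2, 3, 4}" by auto
    have le4: "i \<le> 4 \<longleftrightarrow> i \<in> {0, 1, 2, 3, 4}" for i :: nat by auto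
    have "\<forall>i\<le>4. T i \<in> F"
      using AB flat_in_small[OF H aV] unfolding le4 T_def F_def by (auto simp: eval_nat_numeral)
    moreover have "\<forall>i\<in>{1..4}. T (i - 1) \<subset> T i"
      using AB a unfolding i4 T_def by (auto simp: eval_nat_numeral)
    moreover have "\<forall>i\<in>{1..4}. x i \<in> T i - T (i - 1)"
      using AB a b c unfolding i4 T_def x_def by (auto simp: eval_nat_numeral)
    ultimately have "x ` {1..4} \<in> chain_transversals F"
      unfolding chain_transversals_def by blast
    moreover have "x ` {1..4} = {a, a', b, c}"
      unfolding i4 x_def by (auto simp: eval_nat_numeral)
    moreover have "card {a, a', b, c} = 4" using a b c AB by (auto simp: card_insert_if)
    ultimately show "\<exists>X\<in>chain_transversals F. 3 < card X" by (intro bexI[of _ "x ` {1..4}"]) auto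
  qed
  also have "\<dots> \<longleftrightarrow> (\<exists>A B. flag_pair V A B \<and> pair_faces V A B \<subseteq> H)"
  proof -
    have "A \<in> F \<and> B \<in> F \<longleftrightarrow> pair_faces V A B \<subseteq> H" if "flag_pair V A B" for A B
    proof -
      have "A \<subseteq> V" "B \<subseteq> V" using that by (auto simp: flag_pair_def)
      from pair_faces_subset_iff[OF H this] show ?thesis by (simp add: F_def)
    qed
    then show ?thesis by blast
  qed
  finally show ?thesis .
qed

section \<open>Complexes below \<open>pair_faces\<close> and the class \<open>mGU 2\<close>\<close>

lemma pair_faces_mem:
  assumes "X \<in> pair_faces V A B" "A \<subseteq> V" "B \<subseteq> V"
  shows "X \<subseteq> V" "finite X" "card X \<le> 3"
proof -
  consider "X \<in> subsets_le 2 V" | x y p where "X = {x, y, p}" "x \<in> V" "y \<in> V" "p \<in> V"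
    using assms unfolding pair_faces_def by blast
  then have "X \<subseteq> V \<and> finite X \<and> card X \<le> 3"
    by cases (auto simp: subsets_le_def card_insert_if)
  then show "X \<subseteq> V" "finite X" "card X \<le> 3" by auto
qed

text \<open>Faces have at most three elements, so a proper subset of a face already lies in
  \<open>subsets_le 2 V\<close>; closure under subsets is automatic. The strict inclusion supplies a
  triple and hence dimension exactly two.\<close>

lemma pair_faces_intermediate_Pav:
  assumes fin: "finite V" and AB: "A \<subseteq> V" "B \<subseteq> V"
    and H: "subsets_le 2 V \<subset> H" "H \<subseteq> pair_faces V A B"
  shows "(V, H) \<in> Pav 2"
proof -
  have mem: "X \<subseteq> V" "finite X" "card X \<le> 3" if "X \<in> H" for X
    using pair_faces_mem[of X V A B] that AB H by auto
  obtain X where X: "X \<in> H" "X \<notin> subsets_le 2 V" using H by blast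
  then have X3: "card X = 3" using mem[of X] by (auto simp: subsets_le_def)
  then have "V \<noteq> {}" using mem X by fastforce
  moreover have "{v} \<in> H" if "v \<in> V" for v
    using pair_in_subsets_le[OF that that] H by auto
  moreover have "Z \<in> H" if "Y \<in> H" "Z \<subseteq> Y" for Y Z
  proof (cases "card Z \<le> 2")
    case True
    then have "Z \<in> subsets_le 2 V" using mem[of Y] that by (auto simp: subsets_le_def intro: finite_subset)
    then show ?thesis using H by blast
  next
    case False
    then have "Z = Y" using mem[of Y] that by (intro card_seteq) auto
    then show ?thesis using that by simp
  qed
  ultimately have "simplicial_complex (V, H)"
    using fin mem unfolding simplicial_complex_def by blast
  moreover have "Max (card ` H) = 3"
  proof (rule Max_eqI)
    have "H \<subseteq> Pow V" using mem by auto
    then show "finite (card ` H)" using fin by (meson finite_Pow_iff finite_subset finite_imageI)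
    show "3 \<in> card ` H" using X(1) X3 by force
  qed (use mem in auto)
  ultimately show ?thesis using H by (auto simp: Pav_def dimension_def)
qed

text \<open>For distinct points this says that the triple meets \<open>T\<close> in exactly two of
  them. Spelling out the cases makes later comparisons propositional.\<close>

definition two_of :: "'a set \<Rightarrow> 'a \<Rightarrow> 'a \<Rightarrow> 'a \<Rightarrow> bool" where
  "two_of T x y z \<longleftrightarrow> x \<in> T \<and> y \<in> T \<and> z \<notin> T \<or> x \<in> T \<and> y \<notin> T \<and> z \<in> T \<or> x \<notin> T \<and> y \<in> T \<and> z \<in> T"

text \<open>Distinctness keeps the triple out of \<open>subsets_le 2 V\<close>, and any
  representation \<open>{u, v, p}\<close> merely permutes the points, with \<open>p\<close> the one
  outside the flat.\<close>

lemma triple_in_pair_faces_iff: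
  assumes "x \<noteq> y" "x \<noteq> z" "y \<noteq> z" "A \<subseteq> V" "B \<subseteq> V" "x \<in> V" "y \<in> V" "z \<in> V"
  shows "{x, y, z} \<in> pair_faces V A B \<longleftrightarrow> two_of A x y z \<or> two_of B x y z"
proof -
  have aux: "(\<exists>u v p. {x, y, z} = {u, v, p} \<and> u \<in> T \<and> v \<in> T \<and> p \<in> V - T) \<longleftrightarrow> two_of T x y z" for T
  proof
    assume "\<exists>u v p. {x, y, z} = {u, v, p} \<and> u \<in> T \<and> v \<in> T \<and> p \<in> V - T"
    then obtain u v p where e: "{x, y, z} = {u, v, p}" and uvp: "u \<in> T" "v \<in> T" "p \<in> V - T" by blast
    then have "p = x \<or> p = y \<or> p = z" by auto
    then show "two_of T x y z"
    proof (elim disjE)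
      assume "p = x"
      then have "y \<in> {u, v}" "z \<in> {u, v}" using e assms(1-3) by blast+
      then show ?thesis using \<open>p = x\<close> uvp by (auto simp: two_of_def)
    next
      assume "p = y"
      then have "x \<in> {u, v}" "z \<in> {u, v}" using e assms(1-3) by blast+
      then show ?thesis using \<open>p = y\<close> uvp by (auto simp: two_of_def)
    next
      assume "p = z"
      then have "x \<in> {u, v}" "y \<in> {u, v}" using e assms(1-3) by blast+
      then show ?thesis using \<open>p = z\<close> uvp by (auto simp: two_of_def)
    qed
  next
    have "{x, y, z} = {x, z, y}" "{x, y, z} = {y, z, x}" by auto
    moreover assume "two_of T x y z"
    ultimately show "\<exists>u v p. {x, y, z} = {u, v, p} \<and> u \<in> T \<and> v \<in> T \<and> p \<in> V - T"
      using assms(6-8) unfolding two_of_def by blast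
  qed
  have "{x, y, z} \<notin> subsets_le 2 V" using assms(1-3) by (simp add: subsets_le_def)
  then show ?thesis using aux[of A] aux[of B] unfolding pair_faces_def by blast
qed

text \<open>Two points of \<open>A\<close> and one of \<open>B - A\<close> form a triple. Strictness
  is what gives dimension two and lets \<open>pair_faces\<close> compete in the definition of
  \<open>mGU\<close>.\<close>

lemma subsets_le_psubset_pair_faces:
  assumes "flag_pair V A B"
  shows "subsets_le 2 V \<subset> pair_faces V A B"
proof -
  obtain a a' where a: "a \<in> A" "a' \<in> A" "a \<noteq> a'"
    using ex_two_elements assms unfolding flag_pair_def by metis
  obtain b where b: "b \<in> B" "b \<notin> A" using assms unfolding flag_pair_def by blast
  have "{a, a', b} \<in> pair_faces V A B"
    using a b assms unfolding pair_faces_def flag_pair_def by blast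
  moreover have "{a, a', b} \<notin> subsets_le 2 V" using a b by (auto simp: subsets_le_def card_insert_if)
  moreover have "subsets_le 2 V \<subseteq> pair_faces V A B" by (simp add: pair_faces_def le_supI1)
  ultimately show ?thesis by (metis psubsetI)
qed

definition minimal_pair :: "'a set \<Rightarrow> 'a set \<Rightarrow> 'a set \<Rightarrow> bool" where
  "minimal_pair V A B \<longleftrightarrow> flag_pair V A B \<and>
     (\<forall>A' B'. flag_pair V A' B' \<and> pair_faces V A' B' \<subseteq> pair_faces V A B
        \<longrightarrow> pair_faces V A' B' = pair_faces V A B)"

lemma pair_faces_GU:
  assumes "finite V" "flag_pair V A B"
  shows "(V, pair_faces V A B) \<in> GU 2"
proof -
  have "(V, pair_faces V A B) \<in> Pav 2"
    using assms subsets_le_psubset_pair_faces[OF assms(2)]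
    by (intro pair_faces_intermediate_Pav[of V A B]) (auto simp: flag_pair_def)
  moreover have "goes_up 2 (V, pair_faces V A B)"
    using assms subsets_le_psubset_pair_faces[OF assms(2)] by (subst goes_up_2_iff) auto
  ultimately show ?thesis by (simp add: GU_def)
qed

text \<open>A complex goes up iff it contains some \<open>pair_faces\<close>, and each
  \<open>pair_faces\<close> of a flag pair goes up itself. So the minimal complexes that go up are
  the minimal members of this family.\<close>

lemma mGU_2_iff:
  "(V, H) \<in> mGU 2 \<longleftrightarrow> finite V \<and> (\<exists>A B. minimal_pair V A B \<and> H = pair_faces V A B)"
proof
  assume m: "(V, H) \<in> mGU 2"
  then have H: "(V, H) \<in> Pav 2" "goes_up 2 (V, H)"
    and min: "\<And>H'. H' \<subset> H \<Longrightarrow> subsets_le 2 V \<subset> H' \<Longrightarrow> \<not> goes_up 2 (V, H')"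
    by (auto simp: mGU_def GU_def NGU_def)
  have fin: "finite V" and sub: "subsets_le 2 V \<subseteq> H"
    using H(1) by (auto simp: Pav_def simplicial_complex_def)
  \<comment> \<open>A proper inclusion would give a smaller complex that goes up.\<close>
  have eq: "pair_faces V A B = H" if "flag_pair V A B" "pair_faces V A B \<subseteq> H" for A B
    using pair_faces_GU[OF fin that(1)] min[of "pair_faces V A B"] that
      subsets_le_psubset_pair_faces[OF that(1)] by (auto simp: GU_def)
  obtain A B where AB: "flag_pair V A B" "pair_faces V A B \<subseteq> H"
    using goes_up_2_iff[OF fin sub] H(2) by blast
  then have "minimal_pair V A B" unfolding minimal_pair_def using eq by blast
  then show "finite V \<and> (\<exists>A B. minimal_pair V A B \<and> H = pair_faces V A B)" using fin eq AB by blast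
next
  assume "finite V \<and> (\<exists>A B. minimal_pair V A B \<and> H = pair_faces V A B)"
  then obtain A B where fin: "finite V" and m: "minimal_pair V A B" and H: "H = pair_faces V A B" by blast
  have AB: "flag_pair V A B" using m by (simp add: minimal_pair_def)
  have "(V, H') \<in> NGU 2" if H': "H' \<subset> H" "subsets_le 2 V \<subset> H'" for H'
  proof -
    have "(V, H') \<in> Pav 2" using AB fin H that
      by (intro pair_faces_intermediate_Pav[of V A B]) (auto simp: flag_pair_def)
    moreover have "\<not> goes_up 2 (V, H')"
    proof
      assume "goes_up 2 (V, H')"
      then obtain A' B' where "flag_pair V A' B'" "pair_faces V A' B' \<subseteq> H'"
        using goes_up_2_iff[OF fin psubset_imp_subset[OF H'(2)]] by blast
      moreover from this have "pair_faces V A' B' = H"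
        using m H' H unfolding minimal_pair_def by (metis order_trans psubset_imp_subset)
      ultimately show False using H' by blast
    qed
    ultimately show ?thesis by (simp add: NGU_def)
  qed
  then show "(V, H) \<in> mGU 2" using pair_faces_GU[OF fin AB] H by (auto simp: mGU_def)
qed

section \<open>Which flag pairs are minimal\<close>

text \<open>The flat condition in contrapositive form, as a closure rule: nonfaces propagate
  membership in a flat.\<close>

lemma flat_inD:
  assumes "flat_in V H T" "x \<in> T" "y \<in> T" "{x, y, p} \<notin> H" "p \<in> V"
  shows "p \<in> T"
  using assms by (auto simp: flat_in_def)

text \<open>Any two points of \<open>T\<close> absorb every point that forms a nonface with them,
  that is, a triple meeting neither \<open>A\<close> nor \<open>B\<close> in exactly two points. The
  cases are the possible positions of the two points.\<close>

lemma flat_pair_faces_generic: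
  assumes fin: "finite V" and AB: "flag_pair V A B"
    and M: "2 \<le> card (B - A)" and C: "2 \<le> card (V - B)"
    and T: "flat_in V (pair_faces V A B) T" "2 \<le> card T" "T \<noteq> V"
  shows "T = A \<or> T = B"
proof -
  have sub: "A \<subseteq> B" "A \<subseteq> V" "B \<subseteq> V" "T \<subseteq> V"
    using AB T by (auto simp: flag_pair_def flat_in_def)
  have cl: "p \<in> T" if "x \<in> T" "y \<in> T" "p \<in> V" "x \<noteq> y" "\<not> two_of A x y p" "\<not> two_of B x y p" for x y p
  proof (cases "p = x \<or> p = y")
    case False
    then have "{x, y, p} \<notin> pair_faces V A B"
      using triple_in_pair_faces_iff[of x y p A V B] that sub by auto
    then show ?thesis using flat_inD[OF T(1)] that by blast
  qed (use that in auto)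
  obtain c c' where c: "c \<in> V - B" "c' \<in> V - B" "c \<noteq> c'" using ex_two_elements[OF C] .
  obtain m m' where m: "m \<in> B - A" "m' \<in> B - A" "m \<noteq> m'" using ex_two_elements[OF M] .
  \<comment> \<open>A triple with two points outside \<open>B\<close> has at most one point in
    \<open>A\<close> and in \<open>B\<close>, so such a pair would absorb all of
    \<open>V\<close>.\<close>
  have cc: False if "x \<in> T" "y \<in> T" "x \<notin> B" "y \<notin> B" "x \<noteq> y" for x y
    using cl[of x y] that sub T(3) unfolding two_of_def by blast
  have TB: "T \<subseteq> B"
  proof
    fix x assume x: "x \<in> T"
    show "x \<in> B"
    proof (rule ccontr)
      assume xB: "x \<notin> B"
      have "T \<noteq> {x}" using T(2) by auto
      then obtain y where y: "y \<in> T" "y \<noteq> x" using x by blast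
      then have yB: "y \<in> B" using cc x xB by blast
      \<comment> \<open>One point inside and one outside \<open>B\<close> absorb
        \<open>V - B\<close>, which has two points, so \<open>cc\<close> applies.\<close>
      have "p \<in> T" if "p \<in> V - B" for p
        using cl[of x y p] x y xB yB that sub unfolding two_of_def by blast
      then show False using c cc by blast
    qed
  qed
  \<comment> \<open>Within \<open>B\<close>, triples with two points off \<open>A\<close> have three
    points in \<open>B\<close> and at most one in \<open>A\<close>, so \<open>T\<close> fills
    \<open>B\<close>.\<close>
  have mm: "T = B" if "x \<in> T" "y \<in> T" "x \<notin> A" "y \<notin> A" "x \<noteq> y" for x y
  proof -
    have "p \<in> T" if "p \<in> B" for p
      using cl[of x y p] \<open>x \<in> T\<close> \<open>y \<in> T\<close> \<open>x \<notin> A\<close> \<open>y \<notin> A\<close> \<open>x \<noteq> y\<close> TB that sub unfolding two_of_def by blast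
    then show ?thesis using TB by blast
  qed
  show ?thesis
  proof (cases "T \<subseteq> A")
    case True
    obtain x y where xy: "x \<in> T" "y \<in> T" "x \<noteq> y" using ex_two_elements[OF T(2)] .
    \<comment> \<open>A triple inside \<open>A\<close> meets both \<open>A\<close> and
      \<open>B\<close> in three points, so it is a nonface.\<close>
    have "p \<in> T" if "p \<in> A" for p
      using cl[of x y p] xy True that sub unfolding two_of_def by blast
    then show ?thesis using True by blast
  next
    case False
    then obtain x where x: "x \<in> T" "x \<notin> A" by blast
    have "T \<noteq> {x}" using T(2) by auto
    then obtain y where y: "y \<in> T" "y \<noteq> x" using x by blast
    show ?thesis
    proof (cases "y \<in> A")
      case True
      \<comment> \<open>One point in \<open>A\<close> and one in \<open>B - A\<close> absorb the
        rest of \<open>B - A\<close>, reducing to \<open>mm\<close>.\<close>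
      have "p \<in> T" if "p \<in> B - A" for p
        using cl[of x y p] x y True TB that sub unfolding two_of_def by blast
      then show ?thesis using m mm by blast
    next
      case False
      then show ?thesis using mm x y by blast
    qed
  qed
qed

text \<open>\<open>A'\<close> and \<open>B'\<close> are proper flats of
  \<open>pair_faces V A B\<close>, hence among \<open>A\<close> and \<open>B\<close>, and strict
  inclusion fixes the order. Recovering the pair itself later yields isomorphism invariants.\<close>

lemma minimal_pair_generic:
  assumes fin: "finite V" and AB: "flag_pair V A B"
    and M: "2 \<le> card (B - A)" and C: "2 \<le> card (V - B)"
    and sub: "flag_pair V A' B'" "pair_faces V A' B' \<subseteq> pair_faces V A B"
  shows "A' = A \<and> B' = B"
proof -
  have V: "A' \<subseteq> V" "B' \<subseteq> V" "A' \<noteq> V" "B' \<noteq> V" "2 \<le> card A'" "A' \<subset> B'" "A \<subset> B"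
    using sub(1) AB by (auto simp: flag_pair_def)
  have "card A' \<le> card B'" using V fin by (meson card_mono finite_subset psubset_imp_subset)
  then have "2 \<le> card B'" using V by simp
  moreover have "flat_in V (pair_faces V A B) A'" "flat_in V (pair_faces V A B) B'"
    using sub(2) pair_faces_subset_iff[of V "pair_faces V A B" A' B'] V
    by (auto simp: pair_faces_def)
  ultimately have "A' = A \<or> A' = B" "B' = A \<or> B' = B"
    using flat_pair_faces_generic[OF fin AB M C] V by blast+
  then show ?thesis using V by blast
qed

text \<open>Reduces an inclusion of complexes to statements about distinct triples; degenerate ones
  lie in \<open>subsets_le 2 V\<close>.\<close>

lemma pair_faces_subset_triples:
  assumes A: "A' \<subseteq> V" "B' \<subseteq> V" "A \<subseteq> V" "B \<subseteq> V"
    and tr: "\<And>x y z. \<lbrakk>x \<in> V; y \<in> V; z \<in> V; x \<noteq> y; x \<noteq> z; y \<noteq> z; x \<in> A'; y \<in> A'; z \<notin> A'\<rbrakk>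
               \<Longrightarrow> two_of A x y z \<or> two_of B x y z"
            "\<And>x y z. \<lbrakk>x \<in> V; y \<in> V; z \<in> V; x \<noteq> y; x \<noteq> z; y \<noteq> z; x \<in> B'; y \<in> B'; z \<notin> B'\<rbrakk>
               \<Longrightarrow> two_of A x y z \<or> two_of B x y z"
  shows "pair_faces V A' B' \<subseteq> pair_faces V A B"
proof -
  have *: "{x, y, p} \<in> pair_faces V A B"
    if "x \<in> V" "y \<in> V" "p \<in> V" "x \<noteq> p" "y \<noteq> p"
      "x \<noteq> y \<Longrightarrow> two_of A x y p \<or> two_of B x y p" for x y p
  proof (cases "x = y")
    case True
    then show ?thesis using pair_in_subsets_le[of x V p] that by (simp add: pair_faces_def)
  next
    case False
    then show ?thesis using triple_in_pair_faces_iff[of x y p A V B] that A by blast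
  qed
  have "flat_in V (pair_faces V A B) A'"
    unfolding flat_in_def
  proof (intro conjI ballI)
    fix x y p assume xyp: "x \<in> A'" "y \<in> A'" "p \<in> V - A'"
    then have "x \<in> V" "y \<in> V" "p \<in> V" "x \<noteq> p" "y \<noteq> p" using A by auto
    then show "{x, y, p} \<in> pair_faces V A B"
      using xyp by (intro * tr(1)) auto
  qed (use A in simp)
  moreover have "flat_in V (pair_faces V A B) B'"
    unfolding flat_in_def
  proof (intro conjI ballI)
    fix x y p assume xyp: "x \<in> B'" "y \<in> B'" "p \<in> V - B'"
    then have "x \<in> V" "y \<in> V" "p \<in> V" "x \<noteq> p" "y \<noteq> p" using A by auto
    then show "{x, y, p} \<in> pair_faces V A B"
      using xyp by (intro * tr(2)) auto
  qed (use A in simp)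
  moreover have "subsets_le 2 V \<subseteq> pair_faces V A B" by (auto simp: pair_faces_def)
  ultimately show ?thesis using pair_faces_subset_iff A by blast
qed

text \<open>A triple inside \<open>B\<close> is all of \<open>B\<close> and so has exactly two
  points in \<open>A\<close>. The right-hand side no longer involves \<open>A\<close>.\<close>

lemma triple_2_3_iff:
  assumes "card A = 2" "card B = 3" "A \<subseteq> B" "x \<noteq> y" "x \<noteq> z" "y \<noteq> z"
  shows "two_of A x y z \<or> two_of B x y z \<longleftrightarrow> x \<in> B \<and> y \<in> B \<or> x \<in> B \<and> z \<in> B \<or> y \<in> B \<and> z \<in> B"
proof -
  obtain a a' where A: "A = {a, a'}" "a \<noteq> a'" using assms(1) by (auto simp: card_2_iff)
  have finB: "finite B" using assms(2) by (auto intro: card_ge_0_finite)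
  have "card (B - A) = 1" using assms finB by (subst card_Diff_subset) (auto intro: finite_subset)
  then obtain b where b: "B - A = {b}" by (auto simp: card_1_singleton_iff)
  then have B: "B = {a, a', b}" "b \<noteq> a" "b \<noteq> a'" using A assms(3) by auto
  show ?thesis using assms(4-6) A B unfolding two_of_def by auto
qed

text \<open>With at least five vertices, a competing \<open>B'\<close> is a flat and must equal
  \<open>B\<close>. With four vertices, the sizes are forced to be 2 and 3, and every triple meets
  \<open>B'\<close> in at least two points.\<close>

lemma minimal_pair_2_3:
  assumes fin: "finite V" and AB: "flag_pair V A B" and c: "card A = 2" "card B = 3"
  shows "minimal_pair V A B"
proof -
  have sub: "A \<subseteq> B" "A \<subseteq> V" "B \<subseteq> V" using AB by (auto simp: flag_pair_def)
  have finB: "finite B" using sub fin finite_subset by blast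
  have eq: "pair_faces V A B \<subseteq> pair_faces V A' B'"
    if m: "flag_pair V A' B'" "pair_faces V A' B' \<subseteq> pair_faces V A B" for A' B'
  proof -
    have s: "A' \<subset> B'" "B' \<subset> V" "2 \<le> card A'" "A' \<subseteq> V" "B' \<subseteq> V" using m by (auto simp: flag_pair_def)
    have finB': "finite B'" using s fin finite_subset by blast
    have lt: "card A' < card B'" "card B' < card V"
      using s fin finB' by (auto intro: psubset_card_mono)
    have B': "card B' = 3 \<and> (B' = B \<or> card V = 4)"
    proof (cases "card V = 4")
      case True
      then show ?thesis using lt s by auto
    next
      case False
      have "card B < card V" using AB fin by (auto simp: flag_pair_def intro: psubset_card_mono)
      then have "2 \<le> card (V - B)" using False c finB sub by (subst card_Diff_subset) auto
      then obtain d d' where d: "d \<in> V - B" "d' \<in> V - B" "d \<noteq> d'" by (rule ex_two_elements)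
      have fl: "flat_in V (pair_faces V A B) B'"
        using pair_faces_subset_iff[of V "pair_faces V A B" A' B'] m s by (auto simp: pair_faces_def)
      \<comment> \<open>Such a triple has at most one point in \<open>B\<close>, hence is a
        nonface.\<close>
      have cl: "p \<in> B'" if "x \<in> B'" "y \<in> B'" "p \<in> V" "x \<noteq> y" "x \<notin> B" "y \<notin> B \<or> p \<notin> B" for x y p
      proof (cases "p = x \<or> p = y")
        case False
        then have "{x, y, p} \<notin> pair_faces V A B"
          using triple_in_pair_faces_iff[of x y p A V B] triple_2_3_iff[OF c sub(1), of x y p] that sub
            subsetD[OF s(5) that(1)] subsetD[OF s(5) that(2)] by auto
        then show ?thesis using flat_inD[OF fl] that by blast
      qed (use that in auto)
      have one: "x = y" if "x \<in> B'" "y \<in> B'" "x \<notin> B" "y \<notin> B" for x y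
        using cl[of x y] that s by blast
      have "B' \<subseteq> B"
      proof
        fix x assume x: "x \<in> B'"
        show "x \<in> B"
        proof (rule ccontr)
          assume xB: "x \<notin> B"
          have "B' \<noteq> {x}" using s lt by auto
          then obtain y where y: "y \<in> B'" "y \<noteq> x" using x by blast
          have "d \<in> B'" "d' \<in> B'" using cl[of x y] d x y xB by auto
          then show False using one d by blast
        qed
      qed
      moreover have "3 \<le> card B'" using lt s by simp
      ultimately have "B' = B" using finB c by (intro card_seteq) auto
      then show ?thesis using c by simp
    qed
    then have "card A' = 2" "A' \<subseteq> B'" using lt s by auto
    note t' = triple_2_3_iff[OF this(1) _ this(2)]
    have "x \<in> B' \<and> y \<in> B' \<or> x \<in> B' \<and> z \<in> B' \<or> y \<in> B' \<and> z \<in> B'"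
      if "x \<in> V" "y \<in> V" "z \<in> V" "x \<noteq> y" "x \<noteq> z" "y \<noteq> z"
        "x \<in> B \<and> y \<in> B \<or> x \<in> B \<and> z \<in> B \<or> y \<in> B \<and> z \<in> B" for x y z
    proof (cases "B' = B")
      \<comment> \<open>Here there are four vertices, and only one of them is outside
        \<open>B'\<close>.\<close>
      case False
      then have "card (V - B') = 1" using B' fin finB' s by (subst card_Diff_subset) auto
      then obtain d where "V - B' = {d}" by (auto simp: card_1_singleton_iff)
      then have "x \<in> B' \<or> x = d" "y \<in> B' \<or> y = d" "z \<in> B' \<or> z = d" using that(1-3) by blast+
      then show ?thesis using that(4-6) by blast
    qed (use that in simp)
    then have key: "two_of A' x y z \<or> two_of B' x y z"
      if "x \<in> V" "y \<in> V" "z \<in> V" "x \<noteq> y" "x \<noteq> z" "y \<noteq> z" "two_of A x y z \<or> two_of B x y z" for x y z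
      using that t'[of x y z] B' triple_2_3_iff[OF c sub(1), of x y z] by blast
    show ?thesis
    proof (rule pair_faces_subset_triples)
      fix x y z assume "x \<in> V" "y \<in> V" "z \<in> V" "x \<noteq> y" "x \<noteq> z" "y \<noteq> z" "x \<in> A" "y \<in> A" "z \<notin> A"
      then show "two_of A' x y z \<or> two_of B' x y z" by (intro key) (auto simp: two_of_def)
    next
      fix x y z assume "x \<in> V" "y \<in> V" "z \<in> V" "x \<noteq> y" "x \<noteq> z" "y \<noteq> z" "x \<in> B" "y \<in> B" "z \<notin> B"
      then show "two_of A' x y z \<or> two_of B' x y z" by (intro key) (auto simp: two_of_def)
    qed (use s sub in auto)
  qed
  show ?thesis unfolding minimal_pair_def using AB eq by blast
qed

section \<open>Reduction to the sizes in \<open>Q_set\<close>\<close>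

text \<open>If the sizes are not in \<open>Q_set\<close>, then \<open>B - A\<close> or
  \<open>V - B\<close> is a singleton. Regrouping its point with points of \<open>A\<close> gives a
  pair with admissible sizes whose complex is contained in the given one; minimality makes them
  equal.\<close>

lemma minimal_pair_representative:
  assumes fin: "finite V" and m: "minimal_pair V A B"
  obtains A' B' where "flag_pair V A' B'" "pair_faces V A' B' = pair_faces V A B"
    "(card A', card B') \<in> Q_set (card V)"
proof -
  have AB: "flag_pair V A B" using m by (simp add: minimal_pair_def)
  then have sub: "A \<subset> B" "B \<subset> V" "A \<subseteq> V" "B \<subseteq> V" "2 \<le> card A" by (auto simp: flag_pair_def)
  have finB: "finite B" using sub fin finite_subset by blast
  have finA: "finite A" using sub finB finite_subset by blast
  have lt: "card A < card B" "card B < card V"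
    using sub fin finB by (auto intro: psubset_card_mono)
  have min: "pair_faces V A' B' = pair_faces V A B"
    if "flag_pair V A' B'" "pair_faces V A' B' \<subseteq> pair_faces V A B" for A' B'
    using m that by (simp add: minimal_pair_def)
  obtain a a' where a: "a \<in> A" "a' \<in> A" "a \<noteq> a'" using ex_two_elements[OF sub(5)] .
  obtain b where b: "b \<in> B" "b \<notin> A" using sub by blast
  obtain c where c: "c \<in> V" "c \<notin> B" using sub by blast
  have ne: "b \<noteq> a" "b \<noteq> a'" "c \<noteq> a" "c \<noteq> a'" "c \<noteq> b" and in_V: "a \<in> V" "a' \<in> V" "b \<in> V"
    using a b c sub by auto
  have in_A: "u \<in> A \<longleftrightarrow> u \<in> B \<and> u \<noteq> b" if "card A + 1 = card B" for u
  proof -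
    have "card (B - A) = 1" using that finA sub by (subst card_Diff_subset) auto
    then obtain x where "B - A = {x}" by (auto simp: card_1_singleton_iff)
    moreover have "b \<in> B - A" using b by simp
    ultimately have "B - A = {b}" by auto
    then show ?thesis using sub(1) by blast
  qed
  have in_B: "u \<in> B \<longleftrightarrow> u \<in> V \<and> u \<noteq> c" if "card B + 1 = card V" for u
  proof -
    have "card (V - B) = 1" using that finB sub by (subst card_Diff_subset) auto
    then obtain x where "V - B = {x}" by (auto simp: card_1_singleton_iff)
    moreover have "c \<in> V - B" using c by simp
    ultimately have "V - B = {c}" by auto
    then show ?thesis using sub(2) by blast
  qed
  \<comment> \<open>The first four cases cover the singleton gaps; the last covers two gaps of size
    at least two, or sizes 2 and 3.\<close>
  consider "card B + 1 = card V" "card A = 2"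
    | "card B + 1 = card V" "2 < card A" "card A + 1 = card B"
    | "card B + 1 = card V" "2 < card A" "card A + 1 < card B"
    | "card B + 1 < card V" "2 < card A" "card A + 1 = card B"
    | "(card A, card B) \<in> Q_set (card V)"
  proof -
    have "2 \<le> card A \<and> card A + 1 < card B \<and> card B + 1 < card V \<or> card A = 2 \<and> card B = 3
        \<Longrightarrow> (card A, card B) \<in> Q_set (card V)" by (auto simp: Q_set_def)
    then show ?thesis using that lt sub(5) by linarith
  qed
  then show ?thesis
  proof cases
    case 1
    have A: "A = {a, a'}"
      using a 1 finA by (intro card_seteq[symmetric]) auto
    have "flag_pair V {a, a'} {a, a', c}"
      using a in_V b c ne by (auto simp: flag_pair_def)
    moreover have "pair_faces V {a, a'} {a, a', c} \<subseteq> pair_faces V A B"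
      using A in_B[OF 1(1)] in_V ne c sub(3,4) a(3)
      by (intro pair_faces_subset_triples) (auto simp: two_of_def)
    moreover have "(card {a, a'}, card {a, a', c}) \<in> Q_set (card V)" using a ne by (auto simp: Q_set_def)
    ultimately show ?thesis using that min by blast
  next
    case 2
    have "flag_pair V {a, c} {a, b, c}"
      using a in_V b c ne by (auto simp: flag_pair_def)
    moreover have "pair_faces V {a, c} {a, b, c} \<subseteq> pair_faces V A B"
      using in_A[OF 2(3)] in_B[OF 2(1)] in_V ne c sub(3,4)
      by (intro pair_faces_subset_triples) (auto simp: two_of_def)
    moreover have "(card {a, c}, card {a, b, c}) \<in> Q_set (card V)" using ne by (auto simp: Q_set_def)
    ultimately show ?thesis using that min by blast
  next
    case 3
    have "c \<notin> A" using c sub by auto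
    \<comment> \<open>The complement of \<open>insert c A\<close> is \<open>B - A\<close>, which has
      at least two points here.\<close>
    have "flag_pair V {a, c} (insert c A)"
      using a in_V b c ne sub by (auto simp: flag_pair_def)
    moreover have "pair_faces V {a, c} (insert c A) \<subseteq> pair_faces V A B"
      using in_B[OF 3(1)] in_V ne c sub(3,4) a(1) \<open>c \<notin> A\<close>
      by (intro pair_faces_subset_triples) (auto simp: two_of_def)
    moreover have "(card {a, c}, card (insert c A)) \<in> Q_set (card V)"
      using ne 3 finA \<open>c \<notin> A\<close> by (auto simp: Q_set_def)
    ultimately show ?thesis using that min by blast
  next
    case 4
    have "flag_pair V {a, b} B" using a b ne sub by (auto simp: flag_pair_def)
    moreover have "pair_faces V {a, b} B \<subseteq> pair_faces V A B"
      using in_A[OF 4(3)] in_V ne sub(3,4) a(1) b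
      by (intro pair_faces_subset_triples) (auto simp: two_of_def)
    moreover have "(card {a, b}, card B) \<in> Q_set (card V)" using ne 4 by (auto simp: Q_set_def)
    ultimately show ?thesis using that min by blast
  next
    case 5
    then show ?thesis using that AB by blast
  qed
qed

text \<open>Apart from \<open>(2, 3)\<close>, the inequalities in \<open>Q_set\<close> say that both
  gaps \<open>B - A\<close> and \<open>V - B\<close> have at least two elements.\<close>

lemma minimal_pair_Q_set:
  assumes fin: "finite V" and AB: "flag_pair V A B" and Q: "(card A, card B) \<in> Q_set (card V)"
  shows "minimal_pair V A B"
proof (cases "card A = 2 \<and> card B = 3")
  case True
  then show ?thesis using minimal_pair_2_3[OF fin AB] by simp
next
  case False
  have sub: "A \<subseteq> B" "B \<subseteq> V" using AB by (auto simp: flag_pair_def)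
  then have "finite B" "finite A" using fin by (auto intro: finite_subset)
  then have "2 \<le> card (B - A)" "2 \<le> card (V - B)"
    using False Q sub by (auto simp: Q_set_def card_Diff_subset)
  then show ?thesis using minimal_pair_generic[OF fin AB] AB unfolding minimal_pair_def by blast
qed

section \<open>Transport along bijections and the complexes \<open>J_complex\<close>\<close>

lemma image_subsets_le:
  assumes "bij_betw f V W"
  shows "(`) f ` subsets_le k V = subsets_le k W"
proof (intro equalityI subsetI)
  fix Y assume "Y \<in> (`) f ` subsets_le k V"
  then obtain X where X: "X \<subseteq> V" "finite X" "card X \<le> k" "Y = f ` X" by (auto simp: subsets_le_def)
  then show "Y \<in> subsets_le k W"
    using assms card_image_le[OF X(2), of f] by (auto simp: subsets_le_def bij_betw_def)
next
  fix Y assume Y: "Y \<in> subsets_le k W"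
  then have YW: "Y \<subseteq> f ` V" using assms by (auto simp: subsets_le_def bij_betw_def)
  define X where "X = inv_into V f ` Y"
  have "f ` X = Y" unfolding X_def using YW by (rule image_inv_into_cancel[OF refl])
  moreover have "X \<subseteq> V" unfolding X_def using YW by (auto intro: inv_into_into)
  moreover have "finite X" "card X \<le> k"
    using Y card_image_le[of Y "inv_into V f"] by (auto simp: X_def subsets_le_def)
  ultimately show "Y \<in> (`) f ` subsets_le k V" by (auto simp: subsets_le_def)
qed

lemma image_pair_faces:
  assumes f: "bij_betw f V W" and AB: "A \<subseteq> V" "B \<subseteq> V"
  shows "(`) f ` pair_faces V A B = pair_faces W (f ` A) (f ` B)"
proof -
  have "(`) f ` {{x, y, p} | x y p. x \<in> T \<and> y \<in> T \<and> p \<in> V - T}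
      = {{x, y, p} | x y p. x \<in> f ` T \<and> y \<in> f ` T \<and> p \<in> W - f ` T}" (is "?L = ?R") if "T \<subseteq> V" for T
  proof -
    have diff: "W - f ` T = f ` (V - T)"
      using f that by (auto simp: bij_betw_def inj_on_image_set_diff[of f V V T])
    show ?thesis
    proof (intro equalityI subsetI)
      fix Y assume "Y \<in> ?L"
      then obtain x y p where "x \<in> T" "y \<in> T" "p \<in> V - T" "Y = {f x, f y, f p}" by auto
      then show "Y \<in> ?R" unfolding diff by blast
    next
      fix Y assume "Y \<in> ?R"
      then obtain x y p where "x \<in> T" "y \<in> T" "p \<in> V - T" "Y = {f x, f y, f p}" unfolding diff by auto
      then have "{x, y, p} \<in> {{x, y, p} | x y p. x \<in> T \<and> y \<in> T \<and> p \<in> V - T}" "Y = f ` {x, y, p}"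
        by auto
      then show "Y \<in> ?L" by (metis (no_types, lifting) imageI)
    qed
  qed
  then show ?thesis unfolding pair_faces_def image_Un using AB image_subsets_le[OF f] by simp
qed

text \<open>\<open>J_complex\<close> bounds the third vertex of its first family by
  \<open>j\<close>. Beyond \<open>j\<close>, a triple with two vertices in \<open>{1..i}\<close>
  also has two in \<open>{1..j}\<close> and belongs to the second family.\<close>

lemma J_complex_eq:
  assumes "2 \<le> i" "i < j" "j < n"
  shows "J_complex i j n = ({1..n}, pair_faces {1..n} {1..i} {1..j})"
proof -
  let ?P = "pair_faces {1..n} {1..i} {1..j}"
  let ?J = "snd (J_complex i j n)"
  have "?J \<subseteq> ?P"
  proof
    fix X assume "X \<in> ?J"
    then consider "X \<in> subsets_le 2 {1..n}"
      | a a' b where "X = {a, a', b}" "1 \<le> a" "a < a'" "a' \<le> i" "i < b" "b \<le> j"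
      | b b' c where "X = {b, b', c}" "1 \<le> b" "b < b'" "b' \<le> j" "j < c" "c \<le> n"
      unfolding J_complex_def snd_conv by blast
    then show "X \<in> ?P"
    proof cases
      case 1
      then show ?thesis by (simp add: pair_faces_def)
    next
      case (2 a a' b)
      then have "a \<in> {1..i}" "a' \<in> {1..i}" "b \<in> {1..n} - {1..i}" using assms by auto
      then show ?thesis unfolding pair_faces_def 2(1) by blast
    next
      case (3 b b' c)
      then have "b \<in> {1..j}" "b' \<in> {1..j}" "c \<in> {1..n} - {1..j}" by auto
      then show ?thesis unfolding pair_faces_def 3(1) by blast
    qed
  qed
  moreover have "?P \<subseteq> ?J"
  proof -
    have le2: "subsets_le 2 {1..n} \<subseteq> ?J" by (simp add: J_complex_def le_supI1)
    have BBC: "{x, y, p} \<in> ?J" if "x \<in> {1..j}" "y \<in> {1..j}" "x < y" "p \<in> {1..n} - {1..j}" for x y p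
    proof -
      have "1 \<le> x" "y \<le> j" "j < p" "p \<le> n" using that by auto
      then show ?thesis using that(3) unfolding J_complex_def snd_conv by blast
    qed
    have AAB: "{x, y, p} \<in> ?J" if "x \<in> {1..i}" "y \<in> {1..i}" "x < y" "p \<in> {1..n} - {1..i}" for x y p
    proof (cases "p \<le> j")
      case True
      then have "1 \<le> x" "y \<le> i" "i < p" "p \<le> j" using that by auto
      then show ?thesis using that(3) unfolding J_complex_def snd_conv by blast
    next
      case False
      then show ?thesis using that assms by (intro BBC) auto
    qed
    have fl: "flat_in {1..n} ?J T"
      if "T \<subseteq> {1..n}" and T: "\<And>x y p. \<lbrakk>x \<in> T; y \<in> T; x < y; p \<in> {1..n} - T\<rbrakk> \<Longrightarrow> {x, y, p} \<in> ?J" for T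
      unfolding flat_in_def
    proof (intro conjI ballI)
      fix x y p assume xyp: "x \<in> T" "y \<in> T" "p \<in> {1..n} - T"
      consider "x < y" | "x = y" | "y < x" by linarith
      then show "{x, y, p} \<in> ?J"
      proof cases
        case 1
        then show ?thesis by (intro T xyp)
      next
        case 2
        have "{x, p} \<in> subsets_le 2 {1..n}" using xyp that(1) by (intro pair_in_subsets_le) auto
        then show ?thesis using subsetD[OF le2] 2 by simp
      next
        case 3
        have "{x, y, p} = {y, x, p}" by auto
        then show ?thesis using T[OF xyp(2,1) 3 xyp(3)] by simp
      qed
    qed (rule that(1))
    have sub: "{1..i} \<subseteq> {1..n}" "{1..j} \<subseteq> {1..n}" using assms by auto
    then have "flat_in {1..n} ?J {1..i}" "flat_in {1..n} ?J {1..j}"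
      using fl[OF sub(1) AAB] fl[OF sub(2) BBC] by blast+
    then show ?thesis using pair_faces_subset_iff[OF le2 sub] by blast
  qed
  ultimately have "?J = ?P" by (rule equalityI)
  moreover have "fst (J_complex i j n) = {1..n}" by (simp add: J_complex_def)
  ultimately show ?thesis by (simp add: prod_eq_iff)
qed

lemma Q_setD:
  assumes "(i, j) \<in> Q_set n" "4 \<le> n"
  shows "2 \<le> i" "i < j" "j < n"
  using assms by (auto simp: Q_set_def)

lemma flag_pair_intervals:
  fixes i j n :: nat
  assumes "2 \<le> i" "i < j" "j < n"
  shows "flag_pair {1..n} {1..i} {1..j}"
proof -
  have "j \<in> {1..j} - {1..i}" "n \<in> {1..n} - {1..j}" using assms by auto
  then show ?thesis using assms unfolding flag_pair_def by fastforce
qed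

lemma J_complex_mGU_on:
  assumes "(i, j) \<in> Q_set n" "4 \<le> n"
  shows "J_complex i j n \<in> mGU_on 2 n"
proof -
  note ij = Q_setD[OF assms]
  have "minimal_pair {1..n} {1..i} {1..j}"
    using flag_pair_intervals[OF ij] assms by (intro minimal_pair_Q_set) auto
  then show ?thesis using J_complex_eq[OF ij] by (auto simp: mGU_on_def mGU_2_iff)
qed

text \<open>Bijections of the blocks \<open>A\<close>, \<open>B - A\<close> and \<open>V - B\<close>
  onto consecutive intervals glue to one of \<open>V\<close> carrying \<open>A\<close> and
  \<open>B\<close> to initial segments.\<close>

lemma isomorphic_J_complex:
  assumes fin: "finite V" and AB: "flag_pair V A B"
  shows "isomorphic (V, pair_faces V A B) (J_complex (card A) (card B) (card V))"
proof -
  have sub: "A \<subset> B" "B \<subset> V" "A \<subseteq> V" "B \<subseteq> V" "2 \<le> card A" using AB by (auto simp: flag_pair_def)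
  have finB: "finite B" and finA: "finite A" using sub fin by (auto intro: finite_subset)
  have lt: "card A < card B" "card B < card V" using sub fin finB by (auto intro: psubset_card_mono)
  obtain f where f: "bij_betw f A {1..card A}"
    using finite_same_card_bij[OF finA, of "{1..card A}"] by auto
  have "card (B - A) = card {card A + 1..card B}" using finA sub by (subst card_Diff_subset) auto
  then obtain g where g: "bij_betw g (B - A) {card A + 1..card B}"
    using finB by (metis finite_Diff finite_atLeastAtMost finite_same_card_bij)
  have "card (V - B) = card {card B + 1..card V}" using finB sub by (subst card_Diff_subset) auto
  then obtain h where h: "bij_betw h (V - B) {card B + 1..card V}"
    using fin by (metis finite_Diff finite_atLeastAtMost finite_same_card_bij)
  define F where "F = (\<lambda>x. if x \<in> A then f x else if x \<in> B then g x else h x)"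
  have FA: "bij_betw F A {1..card A}"
    using f by (rule bij_betw_cong[THEN iffD1, rotated]) (simp add: F_def)
  have FM: "bij_betw F (B - A) {card A + 1..card B}"
    using g by (rule bij_betw_cong[THEN iffD1, rotated]) (simp add: F_def)
  have FC: "bij_betw F (V - B) {card B + 1..card V}"
    using h by (rule bij_betw_cong[THEN iffD1, rotated]) (use sub in \<open>auto simp: F_def\<close>)
  have "bij_betw F (A \<union> (B - A)) ({1..card A} \<union> {card A + 1..card B})"
    using FA FM by (rule bij_betw_combine) auto
  moreover have "A \<union> (B - A) = B" "{1..card A} \<union> {card A + 1..card B} = {1..card B}"
    using sub lt by auto
  ultimately have FB: "bij_betw F B {1..card B}" by simp
  have "bij_betw F (B \<union> (V - B)) ({1..card B} \<union> {card B + 1..card V})"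
    using FB FC by (rule bij_betw_combine) auto
  moreover have "B \<union> (V - B) = V" "{1..card B} \<union> {card B + 1..card V} = {1..card V}"
    using sub lt by auto
  ultimately have FV: "bij_betw F V {1..card V}" by simp
  have "(`) F ` pair_faces V A B = pair_faces {1..card V} {1..card A} {1..card B}"
    using image_pair_faces[OF FV sub(3,4)] FA FB by (simp add: bij_betw_def)
  then show ?thesis
    using FV J_complex_eq[OF sub(5) lt] unfolding isomorphic_def by auto
qed

lemma mGU_on_isomorphic_J_complex:
  assumes "K \<in> mGU_on 2 n"
  shows "\<exists>(i, j) \<in> Q_set n. isomorphic K (J_complex i j n)"
proof -
  obtain V H where K: "K = (V, H)" by (cases K)
  then have "(V, H) \<in> mGU 2" and n: "card V = n" using assms by (auto simp: mGU_on_def)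
  then obtain A B where fin: "finite V" and m: "minimal_pair V A B" and H: "H = pair_faces V A B"
    using mGU_2_iff by blast
  obtain A' B' where A': "flag_pair V A' B'" "pair_faces V A' B' = pair_faces V A B"
    "(card A', card B') \<in> Q_set n"
    using minimal_pair_representative[OF fin m] n by auto
  then have "isomorphic K (J_complex (card A') (card B') n)"
    using isomorphic_J_complex[OF fin A'(1)] K H n by simp
  then show ?thesis using A'(3) by blast
qed

section \<open>Isomorphism as an equivalence relation\<close>

lemma isomorphic_refl: "isomorphic K K"
  unfolding isomorphic_def by (rule exI[of _ id]) simp

lemma isomorphic_trans:
  assumes "isomorphic K L" "isomorphic L M"
  shows "isomorphic K M"
proof -
  obtain f where f: "bij_betw f (fst K) (fst L)" "(`) f ` snd K = snd L"
    using assms(1) unfolding isomorphic_def by blast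
  obtain g where g: "bij_betw g (fst L) (fst M)" "(`) g ` snd L = snd M"
    using assms(2) unfolding isomorphic_def by blast
  have "bij_betw (g \<circ> f) (fst K) (fst M)" using f(1) g(1) by (rule bij_betw_trans)
  moreover have "(`) (g \<circ> f) ` snd K = snd M"
    unfolding f(2)[symmetric] g(2)[symmetric] by (simp add: image_image image_comp)
  ultimately show ?thesis unfolding isomorphic_def by blast
qed

text \<open>The inverse map undoes \<open>f\<close> only on subsets of the vertex set, hence the
  condition on the faces of \<open>K\<close>.\<close>

lemma isomorphic_sym:
  assumes "isomorphic K L" "snd K \<subseteq> Pow (fst K)"
  shows "isomorphic L K"
proof -
  obtain f where f: "bij_betw f (fst K) (fst L)" "(`) f ` snd K = snd L"
    using assms unfolding isomorphic_def by blast
  define g where "g = inv_into (fst K) f"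
  have "g ` f ` X = X" if "X \<in> snd K" for X
    unfolding g_def using that assms(2) f(1) by (intro inv_into_image_cancel) (auto simp: bij_betw_def)
  then have "(`) g ` snd L = snd K" unfolding f(2)[symmetric] image_image by simp
  moreover have "bij_betw g (fst L) (fst K)" unfolding g_def using f(1) by (rule bij_betw_inv_into)
  ultimately show ?thesis unfolding isomorphic_def by blast
qed

lemma mGU_on_faces:
  assumes "K \<in> mGU_on d n"
  shows "snd K \<subseteq> Pow (fst K)"
proof -
  obtain V H where K: "K = (V, H)" by (cases K)
  then have "(V, H) \<in> Pav d" using assms by (simp add: mGU_on_def mGU_def GU_def)
  then show ?thesis by (simp add: K Pav_def simplicial_complex_def)
qed

section \<open>Pairwise nonisomorphism and counting\<close>

text \<open>The isomorphism carries the source pair to a flag pair generating the target complex. A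
  generic target determines its pair, and bijections preserve cardinalities.\<close>

lemma isomorphic_J_complex_generic:
  assumes Q: "(i, j) \<in> Q_set n" "(i', j') \<in> Q_set n" "4 \<le> n" and gen: "(i', j') \<noteq> (2, 3)"
    and iso: "isomorphic (J_complex i j n) (J_complex i' j' n)"
  shows "(i, j) = (i', j')"
proof -
  note ij = Q_setD[OF Q(1,3)] and ij' = Q_setD[OF Q(2,3)]
  have gen': "i' + 2 \<le> j'" "j' + 2 \<le> n" using Q(2) gen by (auto simp: Q_set_def)
  let ?V = "{1..n}"
  obtain f where f: "bij_betw f ?V ?V"
    and img: "(`) f ` pair_faces ?V {1..i} {1..j} = pair_faces ?V {1..i'} {1..j'}"
    using iso unfolding isomorphic_def J_complex_eq[OF ij] J_complex_eq[OF ij'] by auto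
  have inj: "inj_on f ?V" using f by (simp add: bij_betw_def)
  have sub: "{1..i} \<subseteq> ?V" "{1..j} \<subseteq> ?V" using ij by auto
  have cards: "card (f ` {1..i}) = i" "card (f ` {1..j}) = j"
    using inj sub by (auto simp: card_image inj_on_subset)
  have "pair_faces ?V (f ` {1..i}) (f ` {1..j}) \<subseteq> pair_faces ?V {1..i'} {1..j'}"
    using image_pair_faces[OF f sub] img by simp
  moreover have "flag_pair ?V (f ` {1..i}) (f ` {1..j})"
  proof -
    have "f ` {1..i} \<subseteq> f ` {1..j}" using ij by (intro image_mono) auto
    moreover have "f ` {1..j} \<subseteq> ?V" using f sub by (auto simp: bij_betw_def)
    moreover have "f ` {1..i} \<noteq> f ` {1..j}" using cards ij by (metis less_irrefl)
    moreover have "f ` {1..j} \<noteq> ?V" using cards ij by (metis card_atLeastAtMost diff_Suc_1 less_irrefl)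
    ultimately show ?thesis using cards ij by (auto simp: flag_pair_def)
  qed
  moreover have "2 \<le> card ({1..j'} - {1..i'})" "2 \<le> card (?V - {1..j'})"
    using gen' ij' by (auto simp: card_Diff_subset)
  ultimately have "f ` {1..i} = {1..i'} \<and> f ` {1..j} = {1..j'}"
    using minimal_pair_generic[of ?V "{1..i'}" "{1..j'}"] flag_pair_intervals[OF ij'] by simp
  then show ?thesis using cards by simp
qed

lemma J_complex_not_isomorphic:
  assumes Q: "(i, j) \<in> Q_set n" "(i', j') \<in> Q_set n" "4 \<le> n" and ne: "(i, j) \<noteq> (i', j')"
  shows "\<not> isomorphic (J_complex i j n) (J_complex i' j' n)"
proof
  assume iso: "isomorphic (J_complex i j n) (J_complex i' j' n)"
  show False
  proof (cases "(i', j') = (2, 3)")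
    case False
    then show ?thesis using isomorphic_J_complex_generic[OF Q _ iso] ne by blast
  next
    \<comment> \<open>The source is then different from \<open>(2, 3)\<close>, so the roles are
      exchanged.\<close>
    case True
    have "isomorphic (J_complex i' j' n) (J_complex i j n)"
      using isomorphic_sym[OF iso] mGU_on_faces[OF J_complex_mGU_on[OF Q(1,3)]] by blast
    then show ?thesis using isomorphic_J_complex_generic[OF Q(2,1,3)] ne True by metis
  qed
qed

text \<open>With \<open>n = m + 4\<close> there are \<open>m * (m - 1) / 2\<close> generic pairs, by
  induction on \<open>m\<close>, plus the exceptional \<open>(2, 3)\<close>.\<close>

lemma card_Q_set:
  assumes "4 \<le> n"
  shows "real (card (Q_set n)) = (real n ^ 2 - 9 * real n + 22) / 2"
proof -
  define P where "P = (\<lambda>n::nat. {(i::nat, j::nat). 2 \<le> i \<and> i + 2 \<le> j \<and> j + 2 \<le> n})"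
  have P: "finite (P (m + 4)) \<and> 2 * real (card (P (m + 4))) = real m * (real m - 1)" for m
  proof (induction m)
    case 0
    have "P (0 + 4) = {}" by (auto simp: P_def)
    then show ?case by simp
  next
    case (Suc m)
    \<comment> \<open>The new pairs have the largest admissible second entry \<open>m + 3\<close>;
      their first entries run from 2 to \<open>m + 1\<close>.\<close>
    have step: "P (Suc m + 4) = P (m + 4) \<union> (\<lambda>i. (i, m + 3)) ` {2..<m + 2}"
      unfolding P_def by auto
    have "P (m + 4) \<inter> (\<lambda>i. (i, m + 3)) ` {2..<m + 2} = {}" unfolding P_def by auto
    moreover have "card ((\<lambda>i. (i, m + 3)) ` {2..<m + 2}) = m"
      by (subst card_image) (auto simp: inj_on_def)
    ultimately have "card (P (Suc m + 4)) = card (P (m + 4)) + m"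
      using Suc.IH unfolding step by (subst card_Un_disjoint) auto
    then show ?case using Suc.IH step by (simp add: algebra_simps)
  qed
  have "Q_set n = insert (2, 3) (P n)" using assms by (auto simp: Q_set_def P_def)
  moreover have "(2, 3) \<notin> P n" by (simp add: P_def)
  moreover obtain m where m: "n = m + 4" using assms by (metis add.commute le_Suc_ex)
  ultimately have "real (card (Q_set n)) = real (card (P (m + 4))) + 1" using P[of m] by simp
  then show ?thesis using P[of m] m by (simp add: power2_eq_square field_simps)
qed

text \<open>Sending \<open>(i, j)\<close> to the class of \<open>J_complex i j n\<close> is
  injective by nonisomorphism and surjective because every complex has such a
  representative.\<close>

lemma card_mGU_on_quotient:
  assumes "4 \<le> n"
  shows "card ((mGU_on 2 n :: nat scomplex set) // iso_rel_on (mGU_on 2 n)) = card (Q_set n)"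
proof -
  let ?S = "mGU_on 2 n :: nat scomplex set"
  let ?R = "iso_rel_on ?S"
  have equiv: "equiv ?S ?R"
  proof (rule equivI)
    show "?R \<subseteq> ?S \<times> ?S" by (auto simp: iso_rel_on_def)
    show "refl_on ?S ?R" by (auto simp: refl_on_def iso_rel_on_def isomorphic_refl)
    show "sym ?R" by (rule symI) (auto simp: iso_rel_on_def intro: isomorphic_sym dest: mGU_on_faces)
    show "trans ?R" by (rule transI) (auto simp: iso_rel_on_def intro: isomorphic_trans)
  qed
  define c where "c = (\<lambda>(i, j). ?R `` {J_complex i j n})"
  have "bij_betw c (Q_set n) (?S // ?R)"
    unfolding bij_betw_def
  proof (intro conjI inj_onI equalityI subsetI)
    fix p q assume pq: "p \<in> Q_set n" "q \<in> Q_set n" "c p = c q"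
    obtain i j i' j' where p: "p = (i, j)" and q: "q = (i', j')" by (cases p, cases q)
    have "(J_complex i j n, J_complex i' j' n) \<in> ?R"
      using pq J_complex_mGU_on[OF _ assms] eq_equiv_class_iff[OF equiv]
      unfolding p q c_def by auto
    then have "isomorphic (J_complex i j n) (J_complex i' j' n)" by (simp add: iso_rel_on_def)
    then show "p = q" using J_complex_not_isomorphic[of i j n i' j'] pq assms unfolding p q by blast
  next
    fix X assume "X \<in> c ` Q_set n"
    then obtain i j where "(i, j) \<in> Q_set n" "X = ?R `` {J_complex i j n}" unfolding c_def by auto
    then show "X \<in> ?S // ?R" using J_complex_mGU_on[OF _ assms] by (auto intro: quotientI)
  next
    fix X assume "X \<in> ?S // ?R"
    then obtain K where K: "K \<in> ?S" "X = ?R `` {K}" by (auto elim: quotientE)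
    obtain i j where Q: "(i, j) \<in> Q_set n" and iso: "isomorphic K (J_complex i j n)"
      using mGU_on_isomorphic_J_complex[OF K(1)] by blast
    have "(K, J_complex i j n) \<in> ?R"
      using K iso J_complex_mGU_on[OF Q assms] by (simp add: iso_rel_on_def)
    then have "X = c (i, j)" using equiv_class_eq[OF equiv] K by (simp add: c_def)
    then show "X \<in> c ` Q_set n" using Q by blast
  qed
  then show ?thesis by (simp add: bij_betw_same_card)
qed

text \<open>Classes are counted over vertices in \<open>nat\<close>, where the representatives live;
  the last conjunct covers vertices of arbitrary type.\<close>

theorem theorem13p16:
  fixes n :: nat
  assumes "n \<ge> 4"
  shows "real (card ((mGU_on 2 n :: nat scomplex set) // iso_rel_on (mGU_on 2 n)))
           = (real n ^ 2 - 9 * real n + 22) / 2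
       \<and> (\<forall>(i, j) \<in> Q_set n. J_complex i j n \<in> mGU_on 2 n)
       \<and> (\<forall>(i, j) \<in> Q_set n. \<forall>(i', j') \<in> Q_set n.
            (i, j) \<noteq> (i', j') \<longrightarrow> \<not> isomorphic (J_complex i j n) (J_complex i' j' n))
       \<and> (\<forall>K \<in> (mGU_on 2 n :: 'a scomplex set).
            \<exists>(i, j) \<in> Q_set n. isomorphic K (J_complex i j n))"
proof (intro conjI)
  show "real (card ((mGU_on 2 n :: nat scomplex set) // iso_rel_on (mGU_on 2 n)))
           = (real n ^ 2 - 9 * real n + 22) / 2"
    using card_mGU_on_quotient[OF assms] card_Q_set[OF assms] by simp
  show "\<forall>(i, j) \<in> Q_set n. J_complex i j n \<in> mGU_on 2 n"
    using J_complex_mGU_on[OF _ assms] by blast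
  show "\<forall>(i, j) \<in> Q_set n. \<forall>(i', j') \<in> Q_set n.
            (i, j) \<noteq> (i', j') \<longrightarrow> \<not> isomorphic (J_complex i j n) (J_complex i' j' n)"
    using J_complex_not_isomorphic[OF _ _ assms] by blast
  show "\<forall>K \<in> (mGU_on 2 n :: 'a scomplex set). \<exists>(i, j) \<in> Q_set n. isomorphic K (J_complex i j n)"
    using mGU_on_isomorphic_J_complex by blast
qed

end
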